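(* Let $q_+,q_->1$ be integers with $q_+\ne q_-$, let $T=T_{q_+,q_-}$ be the semi-homogeneous tree, $G=\mathrm{Aut}(T)$, $v_0\in V_+$, and let $\phi$ be a spherical function on $V_+$. Then $\phi$ defines a positive functional on the involutive algebra $\ell^1(V_+)$ (that is, the functional $L_\phi(f)=\langle f,\phi\rangle$ is defined on $\ell^1(V_+)$ and $L_\phi(f^* * f)\geqslant 0$ for every $f\in\ell^1(V_+)$) if and only if $\phi$ is bounded and real-valued.
   Context: Tree: $T_{q_+,q_-}$ is the infinite tree whose vertex set $V$ is partitioned as $V_+\sqcup V_-$, where every edge joins a vertex of $V_+$ to a vertex of $V_-$, each vertex of $V_+$ has $q_++1$ neighbors and each vertex of $V_-$ has $q_-+1$ neighbors; $|v|$ is the graph distance of $v$ from $v_0$. The Laplace operator is $\mu_1f(v)=\frac{1}{q_v+1}\sum_{w\sim v}f(w)$, with $q_v=q_\pm$ for $v\in V_\pm$. Spherical functions: for $\gamma\in\mathbb{C}$, $\phi(\,\cdot\,,v_0\,|\,\gamma)$ is the unique function on $V$ that depends only on $|v|$, satisfies $\mu_1\phi=\gamma\phi$ and has value $1$ at $v_0$. A spherical function on $V_+$ is the restriction to $V_+$ of $\phi(\,\cdot\,,v_0\,|\,\gamma)$ for some $\gamma\in\mathbb{C}$. Convolution and involution: $G$ is the locally compact unimodular group of graph automorphisms of $T$, $K=G_{v_0}$ is the compact stabilizer of $v_0$, and Haar measure $d\lambda$ on $G$ is normalized so that $K$ has measure $1$. Since $V_+=Gv_0\cong G/K$, a function $f$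 on $V_+$ is identified with the right-$K$-invariant function $\tau\mapsto f(\tau v_0)$ on $G$. Convolution is $u_1*u_2(\tau)=\int_G u_1(\lambda^{-1}\tau)\,u_2(\lambda)\,d\lambda$. The involution is $f^*(\tau)=\overline{f(\tau^{-1})}$, that is, $f^*(\tau v_0)=\overline{f(\tau^{-1}v_0)}$. The functional $L_\phi$ is $L_\phi(f)=\langle f,\phi\rangle=\sum_{v\in V_+}f(v)\phi(v)$, which in terms of functions on $G$ is $L_\phi(u)=\int_G u(\tau)\,\phi(\tau v_0)\,d\tau$. *)

theory Defs
  imports "HOL-Analysis.Analysis" "HOL-Library.Nonpos_Ints"
begin

text \<open>
  A simple graph is a symmetric irreflexive adjacency relation \<open>E\<close>; its vertex set is the whole
  type \<open>'v\<close>.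
\<close>

definition graph_connected :: "('v \<Rightarrow> 'v \<Rightarrow> bool) \<Rightarrow> bool" where
  "graph_connected E \<longleftrightarrow> (\<forall>u v. E\<^sup>*\<^sup>* u v)"

definition is_cycle :: "('v \<Rightarrow> 'v \<Rightarrow> bool) \<Rightarrow> 'v list \<Rightarrow> bool" where
  "is_cycle E p \<longleftrightarrow> 3 \<le> length p \<and> distinct p \<and> successively E p \<and> E (last p) (hd p)"

definition is_tree :: "('v \<Rightarrow> 'v \<Rightarrow> bool) \<Rightarrow> bool" where
  "is_tree E \<longleftrightarrow> symp E \<and> irreflp E \<and> graph_connected E \<and> (\<nexists>p. is_cycle E p)"

definition gdist :: "('v \<Rightarrow> 'v \<Rightarrow> bool) \<Rightarrow> 'v \<Rightarrow> 'v \<Rightarrow> nat" where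
  "gdist E u v = (LEAST n. (E ^^ n) u v)"

definition semihomogeneous_tree ::
    "('v \<Rightarrow> 'v \<Rightarrow> bool) \<Rightarrow> 'v set \<Rightarrow> 'v set \<Rightarrow> nat \<Rightarrow> nat \<Rightarrow> bool" where
  "semihomogeneous_tree E Vp Vm qp qm \<longleftrightarrow>
     is_tree E \<and>
     Vp \<union> Vm = UNIV \<and> Vp \<inter> Vm = {} \<and>
     (\<forall>u v. E u v \<longrightarrow> (u \<in> Vp \<and> v \<in> Vm) \<or> (u \<in> Vm \<and> v \<in> Vp)) \<and>
     (\<forall>v\<in>Vp. card {w. E v w} = qp + 1) \<and>
     (\<forall>v\<in>Vm. card {w. E v w} = qm + 1)"

definition laplace ::
    "('v \<Rightarrow> 'v \<Rightarrow> bool) \<Rightarrow> 'v set \<Rightarrow> nat \<Rightarrow> nat \<Rightarrow> ('v \<Rightarrow> complex) \<Rightarrow> 'v \<Rightarrow> complex" where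
  "laplace E Vp qp qm f v =
     (\<Sum>w | E v w. f w) / of_nat ((if v \<in> Vp then qp else qm) + 1)"

definition is_spherical ::
    "('v \<Rightarrow> 'v \<Rightarrow> bool) \<Rightarrow> 'v set \<Rightarrow> nat \<Rightarrow> nat \<Rightarrow> 'v \<Rightarrow> complex \<Rightarrow> ('v \<Rightarrow> complex) \<Rightarrow> bool" where
  "is_spherical E Vp qp qm v0 \<gamma> \<Phi> \<longleftrightarrow>
     (\<forall>u v. gdist E v0 u = gdist E v0 v \<longrightarrow> \<Phi> u = \<Phi> v) \<and>
     (\<forall>v. laplace E Vp qp qm \<Phi> v = \<gamma> * \<Phi> v) \<and>
     \<Phi> v0 = 1"

text \<open>
  Functions on \<open>V\<^sub>+\<close> are represented by functions on all vertices whose values outside \<open>V\<^sub>+\<close> are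
  irrelevant.
\<close>

definition spherical_on_Vp ::
    "('v \<Rightarrow> 'v \<Rightarrow> bool) \<Rightarrow> 'v set \<Rightarrow> nat \<Rightarrow> nat \<Rightarrow> 'v \<Rightarrow> ('v \<Rightarrow> complex) \<Rightarrow> bool" where
  "spherical_on_Vp E Vp qp qm v0 \<phi> \<longleftrightarrow>
     (\<exists>\<gamma> \<Phi>. is_spherical E Vp qp qm v0 \<gamma> \<Phi> \<and> (\<forall>v\<in>Vp. \<phi> v = \<Phi> v))"

definition Aut :: "('v \<Rightarrow> 'v \<Rightarrow> bool) \<Rightarrow> ('v \<Rightarrow> 'v) set" where
  "Aut E = {g. bij g \<and> (\<forall>u v. E (g u) (g v) \<longleftrightarrow> E u v)}"

text \<open>The group topology on \<open>Aut E\<close>: pointwise convergence on the discrete set of vertices.\<close>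

definition Aut_topology :: "('v \<Rightarrow> 'v \<Rightarrow> bool) \<Rightarrow> ('v \<Rightarrow> 'v) topology" where
  "Aut_topology E =
     subtopology (product_topology (\<lambda>_. discrete_topology UNIV) UNIV) (Aut E)"

definition stab :: "('v \<Rightarrow> 'v \<Rightarrow> bool) \<Rightarrow> 'v \<Rightarrow> ('v \<Rightarrow> 'v) set" where
  "stab E v0 = {g \<in> Aut E. g v0 = v0}"

text \<open>
  For a connected locally finite graph, the stabilizer of \<open>v\<^sub>0\<close> is a compact open subgroup of the
  second countable group \<open>Aut E\<close>. A left-invariant Borel measure that gives it mass 1 is therefore
  automatically finite on compact sets and regular, so the conditions below characterize the
  normalized Haar measure.
\<close>

definition normalized_haar :: "('v \<Rightarrow> 'v \<Rightarrow> bool) \<Rightarrow> 'v \<Rightarrow> ('v \<Rightarrow> 'v) measure \<Rightarrow> bool" where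
  "normalized_haar E v0 M \<longleftrightarrow>
     space M = Aut E \<and>
     sets M = sigma_sets (Aut E) {U. openin (Aut_topology E) U} \<and>
     (\<forall>g\<in>Aut E. \<forall>A\<in>sets M. emeasure M ((\<lambda>h. g \<circ> h) ` A) = emeasure M A) \<and>
     emeasure M (stab E v0) = 1"

definition lift_fun :: "'v \<Rightarrow> ('v \<Rightarrow> complex) \<Rightarrow> ('v \<Rightarrow> 'v) \<Rightarrow> complex" where
  "lift_fun v0 f \<tau> = f (\<tau> v0)"

text \<open>
  Note the order of the factors: this is the opposite of the more usual
  \<open>\<integral> u\<^sub>1(\<lambda>) u\<^sub>2(\<lambda>\<^sup>-\<^sup>1\<tau>) d\<lambda>\<close>, and the two choices are not interchangeable in what follows.
\<close>

definition convol ::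
    "('v \<Rightarrow> 'v) measure \<Rightarrow> (('v \<Rightarrow> 'v) \<Rightarrow> complex) \<Rightarrow> (('v \<Rightarrow> 'v) \<Rightarrow> complex) \<Rightarrow> ('v \<Rightarrow> 'v) \<Rightarrow> complex" where
  "convol M u1 u2 \<tau> = (LINT l|M. u1 (inv l \<circ> \<tau>) * u2 l)"

definition involution :: "(('v \<Rightarrow> 'v) \<Rightarrow> complex) \<Rightarrow> ('v \<Rightarrow> 'v) \<Rightarrow> complex" where
  "involution u \<tau> = cnj (u (inv \<tau>))"

definition ell1 :: "'v set \<Rightarrow> ('v \<Rightarrow> complex) set" where
  "ell1 Vp = {f. (\<lambda>v. norm (f v)) summable_on Vp}"

definition L_defined_G ::
    "('v \<Rightarrow> 'v) measure \<Rightarrow> 'v \<Rightarrow> ('v \<Rightarrow> complex) \<Rightarrow> (('v \<Rightarrow> 'v) \<Rightarrow> complex) \<Rightarrow> bool" where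
  "L_defined_G M v0 \<phi> u \<longleftrightarrow> integrable M (\<lambda>\<tau>. u \<tau> * \<phi> (\<tau> v0))"

definition L_G ::
    "('v \<Rightarrow> 'v) measure \<Rightarrow> 'v \<Rightarrow> ('v \<Rightarrow> complex) \<Rightarrow> (('v \<Rightarrow> 'v) \<Rightarrow> complex) \<Rightarrow> complex" where
  "L_G M v0 \<phi> u = (LINT \<tau>|M. u \<tau> * \<phi> (\<tau> v0))"

text \<open>
  For \<open>f\<close> in \<open>\<ell>\<^sup>1(V\<^sub>+)\<close> the product \<open>f\<^sup>* * f\<close> is in general only a function on the group, not a
  right-invariant one, so the functional is evaluated on it in its integral form. Integrability is
  required explicitly because the Bochner integral of a non-integrable function is 0 by convention.
\<close>

definition positive_functional ::
    "('v \<Rightarrow> 'v) measure \<Rightarrow> 'v set \<Rightarrow> 'v \<Rightarrow> ('v \<Rightarrow> complex) \<Rightarrow> bool" where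
  "positive_functional M Vp v0 \<phi> \<longleftrightarrow>
     (\<forall>f\<in>ell1 Vp. (\<lambda>v. f v * \<phi> v) summable_on Vp) \<and>
     (\<forall>f\<in>ell1 Vp.
        let F = lift_fun v0 f; u = convol M (involution F) F in
        L_defined_G M v0 \<phi> u \<and> L_G M v0 \<phi> u \<in> \<real>\<^sub>\<ge>\<^sub>0)"

end

theory Submission
  imports Defs
begin

text \<open>
  The order of the factors in the convolution makes \<open>L(f\<^sup>* * f)\<close> split into a product. The orbit
  map \<open>\<tau> \<mapsto> \<tau> v\<^sub>0\<close> turns integrals over the group into sums over \<open>V\<^sub>+\<close>, so for \<open>f\<close> in
  \<open>\<ell>\<^sup>1(V\<^sub>+)\<close> one has \<open>(f\<^sup>* * f)(\<tau>) = (\<Sum>w. f(w) cnj (f(\<tau>\<^sup>-\<^sup>1 w)))\<close>, and hence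
  \<open>L(f\<^sup>* * f) = (\<Sum>w x. f(w) cnj (f(x)) I(w, x))\<close>, where \<open>I(w, x)\<close> is the integral of
  \<open>\<phi>(\<tau> v\<^sub>0)\<close> over the automorphisms \<open>\<tau>\<close> that take \<open>x\<close> to \<open>w\<close>. For such \<open>\<tau>\<close> the vertex
  \<open>\<tau> v\<^sub>0\<close> is uniformly distributed on the sphere about \<open>w\<close> whose radius is the distance \<open>|x|\<close> of
  \<open>x\<close> from \<open>v\<^sub>0\<close>, so \<open>I(w, x)\<close> is a mean of \<open>\<phi>\<close> over that sphere. The functional equation of
  spherical functions evaluates this mean as \<open>\<phi>(w) \<phi>(x)\<close>, and therefore
  \<open>L(f\<^sup>* * f) = (\<Sum>w. f(w) \<phi>(w)) (\<Sum>x. cnj (f(x)) \<phi>(x))\<close>.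

  If \<open>\<phi>\<close> is bounded and real, the second factor is the conjugate of the first and the product is
  \<open>|L(f)|\<^sup>2 \<ge> 0\<close>. Conversely, being defined on all of \<open>\<ell>\<^sup>1(V\<^sub>+)\<close> forces \<open>\<phi>\<close> to be bounded
  (lemma \<open>bounded_if_summable_against_ell1\<close>), and then the test functions
  with value \<open>1\<close> at \<open>v\<^sub>0\<close>, \<open>i t\<close> at \<open>v\<close> and \<open>0\<close> elsewhere give
  \<open>1 + t\<^sup>2 \<phi>(v)\<^sup>2 \<ge> 0\<close> for all real \<open>t\<close>, which is only possible for real \<open>\<phi>(v)\<close>.

  Two facts carry the computation. The first is two-point homogeneity (\<open>two_point_homogeneous\<close>): a
  pair of vertices can be moved to any other pair at the same distance whose first vertex is of the
  same type. It shows that left invariance alone determines the measure of the set of automorphisms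
  with two prescribed values (\<open>emeasure_two_point\<close>), which yields the uniform distribution above
  and stands in for unimodularity. The second is \<open>sphere_sum_eq\<close>: the sums of an eigenfunction
  over the spheres about a vertex obey a linear recursion in the radius that is the same for all
  centres of one type, so they are proportional to the value at the centre.
\<close>

text \<open>
  Absolute summability below always means integrability with respect to the counting measure, so
  that Fubini's theorem applies to sums and integrals alike.
\<close>

no_notation Infinite_Sum.abs_summable_on (infixr \<open>abs'_summable'_on\<close> 46)

section \<open>Distance in a tree\<close>

locale tree_graph =
  fixes E :: "'v \<Rightarrow> 'v \<Rightarrow> bool"
  assumes tree: "is_tree E"
begin

abbreviation dist_E :: "'v \<Rightarrow> 'v \<Rightarrow> nat" where "dist_E \<equiv> gdist E"

definition children :: "'v \<Rightarrow> 'v \<Rightarrow> 'v set" where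
  "children r v = {w. E v w \<and> dist_E r w = Suc (dist_E r v)}"

definition sphere_E :: "'v \<Rightarrow> nat \<Rightarrow> 'v set" where
  "sphere_E r n = {v. dist_E r v = n}"

lemma adj_sym: "E u v \<Longrightarrow> E v u"
  using tree by (auto simp: is_tree_def symp_def)

lemma no_cycle: "\<not> is_cycle E p"
  using tree by (auto simp: is_tree_def)

lemma relpowp_gdist: "(E ^^ dist_E u v) u v"
proof -
  have "E\<^sup>*\<^sup>* u v" using tree by (auto simp: is_tree_def graph_connected_def)
  then obtain n where "(E ^^ n) u v" using rtranclp_imp_relpowp by metis
  then show ?thesis unfolding gdist_def by (rule LeastI)
qed

lemma gdist_le: "(E ^^ n) u v \<Longrightarrow> dist_E u v \<le> n"
  unfolding gdist_def by (rule Least_le)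

lemma gdist_self [simp]: "dist_E u u = 0"
  using gdist_le[of 0 u u] by simp

lemma gdist_eq_0_iff [simp]: "dist_E u v = 0 \<longleftrightarrow> u = v"
  using relpowp_gdist[of u v] by auto

lemma gdist_triangle: "dist_E u w \<le> dist_E u v + dist_E v w"
proof -
  have "(E ^^ (dist_E u v + dist_E v w)) u w"
    unfolding relpowp_add using relpowp_gdist by blast
  then show ?thesis by (rule gdist_le)
qed

lemma relpowp_sym: "(E ^^ n) u v \<Longrightarrow> (E ^^ n) v u"
proof (induction n arbitrary: u)
  case (Suc n)
  from relpowp_Suc_D2[OF Suc.prems] obtain y where "E u y" "(E ^^ n) y v" by blast
  with Suc.IH adj_sym show ?case by (auto intro: relpowp_Suc_I)
qed simp

lemma gdist_sym: "dist_E u v = dist_E v u"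
  by (meson antisym gdist_le relpowp_gdist relpowp_sym)

lemma gdist_adj_le: "E v w \<Longrightarrow> dist_E r w \<le> Suc (dist_E r v)"
  by (meson gdist_le relpowp_Suc_I relpowp_gdist)

lemma closer_neighbour_exists:
  assumes "v \<noteq> r"
  obtains z where "E v z" "dist_E r v = Suc (dist_E r z)"
proof -
  obtain n where n: "dist_E r v = Suc n"
    using assms by (metis gdist_eq_0_iff not0_implies_Suc)
  with relpowp_gdist[of r v] obtain z where z: "(E ^^ n) r z" "E z v"
    by (auto elim: relpowp_Suc_E)
  with gdist_le[of n r z] gdist_adj_le[of z v r] n have "dist_E r z = n" by auto
  with z n show ?thesis using that adj_sym by metis
qed

text \<open>Climb from both vertices towards \<open>r\<close> until the two geodesics meet for the first time: the
  resulting path stays inside the ball, so closing it up from outside, or by an edge on the same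
  level, would produce a cycle.\<close>

lemma path_within_ball:
  assumes "dist_E r x = n" "dist_E r y = n" "x \<noteq> y"
  shows "\<exists>p. 3 \<le> length p \<and> distinct p \<and> successively E p \<and> hd p = x \<and> last p = y
           \<and> (\<forall>z\<in>set p. dist_E r z \<le> n)"
  using assms
proof (induction n arbitrary: x y)
  case (Suc n)
  have "x \<noteq> r" "y \<noteq> r" using Suc.prems by auto
  then obtain x' y' where x': "E x x'" "dist_E r x = Suc (dist_E r x')"
    and y': "E y y'" "dist_E r y = Suc (dist_E r y')"
    using closer_neighbour_exists by metis
  show ?case
  proof (cases "x' = y'")
    case True
    have "E x' y" using y'(1) True adj_sym by blast
    then show ?thesis
      using Suc.prems x' y' by (intro exI[of _ "[x, x', y]"]) auto
  next
    case False
    have "dist_E r x' = n" "dist_E r y' = n" using x' y' Suc.prems by auto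
    from Suc.IH[OF this False] obtain p where p: "3 \<le> length p" "distinct p" "successively E p"
      "hd p = x'" "last p = y'" "\<forall>z\<in>set p. dist_E r z \<le> n"
      by blast
    have "p \<noteq> []" using p(1) by auto
    moreover have "E y' y" using y'(1) by (rule adj_sym)
    moreover have "x \<notin> set p" "y \<notin> set p" using p(6) Suc.prems by auto
    ultimately show ?thesis
      using p x' Suc.prems
      by (intro exI[of _ "x # p @ [y]"])
         (auto simp: successively_append_iff successively_Cons)
  qed
qed auto

text \<open>An edge within a sphere would close the path of the previous lemma to a cycle.\<close>

lemma adj_gdist_cases:
  assumes "E v w"
  shows "dist_E r w = Suc (dist_E r v) \<or> dist_E r v = Suc (dist_E r w)"
proof -
  have "dist_E r v \<noteq> dist_E r w"
  proof
    assume eq: "dist_E r v = dist_E r w"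
    have "v \<noteq> w" using assms tree by (auto simp: is_tree_def irreflp_def)
    from path_within_ball[OF eq refl this] obtain p
      where "3 \<le> length p" "distinct p" "successively E p" "hd p = v" "last p = w" by blast
    with assms adj_sym have "is_cycle E p" by (auto simp: is_cycle_def)
    then show False using no_cycle by blast
  qed
  with gdist_adj_le[OF assms, of r] gdist_adj_le[OF adj_sym[OF assms], of r]
  show ?thesis by linarith
qed

lemma closer_neighbour_unique:
  assumes "E v x" "E v y" "dist_E r v = Suc (dist_E r x)" "dist_E r v = Suc (dist_E r y)"
  shows "x = y"
proof (rule ccontr)
  assume "x \<noteq> y"
  with assms obtain p where p: "3 \<le> length p" "distinct p" "successively E p"
    "hd p = x" "last p = y" "\<forall>z\<in>set p. dist_E r z \<le> dist_E r x"
    using path_within_ball[of r x "dist_E r x" y] by auto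
  have "v \<notin> set p" using p(6) assms(3) by auto
  with p assms adj_sym have "is_cycle E (v # p)"
    by (auto simp: is_cycle_def successively_Cons)
  then show False using no_cycle by blast
qed

definition parent :: "'v \<Rightarrow> 'v \<Rightarrow> 'v" where
  "parent r v = (THE z. E v z \<and> dist_E r v = Suc (dist_E r z))"

lemma parent:
  assumes "v \<noteq> r"
  shows "E v (parent r v)" "dist_E r v = Suc (dist_E r (parent r v))"
proof -
  have "\<exists>!z. E v z \<and> dist_E r v = Suc (dist_E r z)"
    using closer_neighbour_exists[OF assms] closer_neighbour_unique by metis
  from theI'[OF this] show "E v (parent r v)" "dist_E r v = Suc (dist_E r (parent r v))"
    by (auto simp: parent_def)
qed

lemma parent_eq:
  assumes "E v z" "dist_E r v = Suc (dist_E r z)"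
  shows "parent r v = z"
proof -
  have "v \<noteq> r" using assms by auto
  from closer_neighbour_unique[OF _ assms(1) _ assms(2)] parent[OF this] show ?thesis by auto
qed

lemma parent_child: "w \<in> children r v \<Longrightarrow> parent r w = v"
  by (auto simp: children_def intro: parent_eq adj_sym)

lemma child_of_parent: "v \<noteq> r \<Longrightarrow> v \<in> children r (parent r v)"
  using parent[of v r] by (auto simp: children_def intro: adj_sym)

lemma neighbours_eq:
  "{w. E v w} = children r v \<union> (if v = r then {} else {parent r v})"
proof (intro set_eqI iffI)
  fix w assume "w \<in> {w. E v w}"
  then show "w \<in> children r v \<union> (if v = r then {} else {parent r v})"
    using adj_gdist_cases[of v w r] parent_eq[of v w r] by (auto simp: children_def)
next
  fix w assume "w \<in> children r v \<union> (if v = r then {} else {parent r v})"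
  then show "w \<in> {w. E v w}"
    using parent(1)[of v r] by (auto simp: children_def split: if_splits)
qed

lemma parent_not_child: "v \<noteq> r \<Longrightarrow> parent r v \<notin> children r v"
  using parent[of v r] by (auto simp: children_def)

lemma adj_iff_child: "E u v \<longleftrightarrow> v \<in> children r u \<or> u \<in> children r v"
  using adj_gdist_cases[of u v r] adj_sym[of u v] adj_sym[of v u] by (auto simp: children_def)

lemma sphere_E_0: "sphere_E r 0 = {r}"
  by (auto simp: sphere_E_def)

lemma sphere_E_Suc: "sphere_E r (Suc n) = (\<Union>z\<in>sphere_E r n. children r z)"
proof -
  have "v \<in> (\<Union>z\<in>sphere_E r n. children r z)" if "dist_E r v = Suc n" for v
  proof -
    have "v \<noteq> r" using that by auto
    with that parent(2) child_of_parent show ?thesis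
      by (intro UN_I[of "parent r v"]) (auto simp: sphere_E_def)
  qed
  then show ?thesis by (auto simp: sphere_E_def children_def)
qed

lemma children_disjoint: "u \<noteq> v \<Longrightarrow> children r u \<inter> children r v = {}"
  using parent_child by blast

end


section \<open>Two-point homogeneity\<close>

locale semihomogeneous =
  fixes E :: "'v \<Rightarrow> 'v \<Rightarrow> bool" and Vp Vm :: "'v set" and qp qm :: nat
  assumes semihom: "semihomogeneous_tree E Vp Vm qp qm" and q_neq: "qp \<noteq> qm"

sublocale semihomogeneous \<subseteq> tree_graph
  using semihom by unfold_locales (simp add: semihomogeneous_tree_def)

context semihomogeneous
begin

lemma Vm_eq: "Vm = - Vp"
  using semihom by (auto simp: semihomogeneous_tree_def)

lemma adj_Vp: "E u v \<Longrightarrow> v \<in> Vp \<longleftrightarrow> u \<notin> Vp"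
  using semihom unfolding semihomogeneous_tree_def Vm_eq by blast

definition q_at :: "'v \<Rightarrow> nat" where
  "q_at v = (if v \<in> Vp then qp else qm)"

lemma card_neighbours: "card {w. E v w} = Suc (q_at v)"
  using semihom unfolding semihomogeneous_tree_def Vm_eq q_at_def by auto

lemma finite_neighbours: "finite {w. E v w}"
  using card_neighbours[of v] card.infinite by fastforce

lemma finite_children: "finite (children r v)"
  by (rule finite_subset[OF _ finite_neighbours[of v]]) (auto simp: children_def)

lemma card_children: "card (children r v) = (if v = r then Suc (q_at v) else q_at v)"
  using card_neighbours[of v] finite_children[of r v] parent_not_child[of v r]
  unfolding neighbours_eq[of v r] by (auto split: if_splits)

lemma relpowp_Vp: "(E ^^ n) u v \<Longrightarrow> v \<in> Vp \<longleftrightarrow> (even n \<longleftrightarrow> u \<in> Vp)"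
proof (induction n arbitrary: v)
  case (Suc n)
  then obtain y where "(E ^^ n) u y" "E y v" by (auto elim: relpowp_Suc_E)
  with Suc.IH[of y] adj_Vp[of y v] show ?case by auto
qed auto

lemma Vp_iff_even: "v \<in> Vp \<longleftrightarrow> (even (dist_E r v) \<longleftrightarrow> r \<in> Vp)"
  by (rule relpowp_Vp[OF relpowp_gdist])

lemma sphere_E_subset_Vp:
  assumes "a \<in> Vp" "x \<in> Vp" "w \<in> Vp"
  shows "sphere_E w (dist_E a x) \<subseteq> Vp"
proof
  fix y assume "y \<in> sphere_E w (dist_E a x)"
  then show "y \<in> Vp"
    using assms Vp_iff_even[of x a] Vp_iff_even[of y w] by (simp add: sphere_E_def)
qed

lemma finite_sphere_E: "finite (sphere_E r n)"
  by (induction n) (auto simp: sphere_E_0 sphere_E_Suc finite_children)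

text \<open>A map that respects the rooted-tree structure level by level is an automorphism:
  injectivity and surjectivity propagate from each vertex to its children.\<close>

lemma Aut_if_bij_betw_children:
  assumes ga: "g a = c"
    and dist: "\<And>v. dist_E c (g v) = dist_E a v"
    and bij: "\<And>v. bij_betw g (children a v) (children c (g v))"
  shows "g \<in> Aut E"
proof -
  have root_iff: "g v = c \<longleftrightarrow> v = a" for v
    using dist[of v] by (metis gdist_eq_0_iff)
  have par: "parent c (g v) = g (parent a v)" if "v \<noteq> a" for v
    using bij_betwE[OF bij[of "parent a v"]] child_of_parent[OF that] parent_child by blast
  have inj: "g u = g v \<Longrightarrow> dist_E a u = n \<Longrightarrow> u = v" for u v n
  proof (induction n arbitrary: u v)
    case 0
    then show ?case using root_iff[of v] root_iff[of u] by auto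
  next
    case (Suc n)
    have "u \<noteq> a" using Suc.prems by auto
    moreover have "v \<noteq> a" using Suc.prems \<open>u \<noteq> a\<close> root_iff by metis
    ultimately have "g (parent a u) = g (parent a v)" using par Suc.prems(1) by metis
    with Suc.IH[of "parent a u" "parent a v"] parent(2)[OF \<open>u \<noteq> a\<close>] Suc.prems(2)
    have eq: "parent a u = parent a v" by simp
    have "u \<in> children a (parent a u)" "v \<in> children a (parent a u)"
      using child_of_parent[OF \<open>u \<noteq> a\<close>] child_of_parent[OF \<open>v \<noteq> a\<close>] eq by auto
    with bij_betw_imp_inj_on[OF bij[of "parent a u"]] Suc.prems(1) show ?case
      by (auto dest: inj_onD)
  qed
  then have inj_g: "inj g" by (auto intro: injI)
  have surj: "dist_E c w = n \<Longrightarrow> w \<in> range g" for w n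
  proof (induction n arbitrary: w)
    case 0
    then show ?case using ga by auto
  next
    case (Suc n)
    have "w \<noteq> c" using Suc.prems by auto
    with parent(2)[of w c] Suc obtain u where u: "parent c w = g u" by auto
    with child_of_parent[OF \<open>w \<noteq> c\<close>] bij_betw_imp_surj_on[OF bij[of u]] show ?case by auto
  qed
  then have "bij g" using inj_g by (auto simp: bij_def)
  moreover have child_iff: "g v \<in> children c (g u) \<longleftrightarrow> v \<in> children a u" for u v
    using bij_betw_imp_surj_on[OF bij[of u]] inj_g by (metis imageE imageI injD)
  then have "E (g u) (g v) \<longleftrightarrow> E u v" for u v
    unfolding adj_iff_child[of "g u" "g v" c] adj_iff_child[of u v a] by simp
  ultimately show ?thesis by (simp add: Aut_def)
qed

definition geodesic :: "'v \<Rightarrow> 'v \<Rightarrow> 'v set" where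
  "geodesic a b = {v. dist_E a v + dist_E v b = dist_E a b}"

text \<open>Measured from \<open>b\<close>, a child on the geodesic is a neighbour closer to \<open>b\<close>, hence unique; conversely
  stepping towards \<open>b\<close> from a point of the geodesic must, by the triangle inequality, increase the
  distance from \<open>a\<close>.\<close>

lemma card_children_geodesic:
  "card (children a v \<inter> geodesic a b) = (if v \<in> geodesic a b \<and> dist_E a v < dist_E a b then 1 else 0)"
proof (cases "v \<in> geodesic a b \<and> dist_E a v < dist_E a b")
  case True
  then have "v \<noteq> b" by (auto simp: geodesic_def)
  have "children a v \<inter> geodesic a b = {parent b v}"
  proof (intro equalityI subsetI)
    fix w assume "w \<in> children a v \<inter> geodesic a b"
    with True have "E v w" "dist_E b v = Suc (dist_E b w)"
      by (auto simp: children_def geodesic_def gdist_sym[of _ b])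
    then show "w \<in> {parent b v}" using parent_eq by auto
  next
    fix w assume "w \<in> {parent b v}"
    with parent[OF \<open>v \<noteq> b\<close>] have w: "E v w" "dist_E b v = Suc (dist_E b w)" by auto
    with True gdist_triangle[of a b w] adj_gdist_cases[OF w(1), of a]
    show "w \<in> children a v \<inter> geodesic a b"
      by (auto simp: children_def geodesic_def gdist_sym[of _ b])
  qed
  with True show ?thesis by simp
next
  case False
  have "children a v \<inter> geodesic a b = {}"
  proof (rule ccontr)
    assume "children a v \<inter> geodesic a b \<noteq> {}"
    then obtain w where w: "E v w" "dist_E a w = Suc (dist_E a v)"
      "dist_E a w + dist_E w b = dist_E a b" by (auto simp: children_def geodesic_def)
    with gdist_adj_le[OF adj_sym[OF w(1)], of b] gdist_triangle[of a b v] False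
    show False by (auto simp: geodesic_def gdist_sym[of _ b])
  qed
  with False show ?thesis by auto
qed

lemma bij_betw_matching_subset:
  assumes "finite A" "finite B" "card A = card B" "card (A \<inter> D) = card (B \<inter> D')"
  shows "\<exists>f. bij_betw f A B \<and> (\<forall>x\<in>A. f x \<in> D' \<longleftrightarrow> x \<in> D)"
proof -
  obtain f1 where f1: "bij_betw f1 (A \<inter> D) (B \<inter> D')"
    using assms by (metis finite_Int finite_same_card_bij)
  have "card (A - D) = card (B - D')"
    using assms by (simp add: card_Diff_subset_Int)
  then obtain f2 where f2: "bij_betw f2 (A - D) (B - D')"
    using assms by (metis finite_Diff finite_same_card_bij)
  define f where "f = (\<lambda>x. if x \<in> D then f1 x else f2 x)"
  have 1: "bij_betw f (A \<inter> D) (B \<inter> D')"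
    using f1 by (rule bij_betw_cong[THEN iffD1, rotated]) (auto simp: f_def)
  have 2: "bij_betw f (A - D) (B - D')"
    using f2 by (rule bij_betw_cong[THEN iffD1, rotated]) (auto simp: f_def)
  have "bij_betw f ((A \<inter> D) \<union> (A - D)) ((B \<inter> D') \<union> (B - D'))"
    by (rule bij_betw_combine[OF 1 2]) auto
  moreover have "(A \<inter> D) \<union> (A - D) = A" "(B \<inter> D') \<union> (B - D') = B" by auto
  moreover have "f x \<in> D' \<longleftrightarrow> x \<in> D" if "x \<in> A" for x
    using bij_betwE[OF 1] bij_betwE[OF 2] that by blast
  ultimately show ?thesis by metis
qed

text \<open>The two geodesics are matched by asking every bijection between children to respect them;
  this is possible because a vertex has at most one child on the geodesic, and it has one exactly
  when it lies on the geodesic itself and is not the endpoint.\<close>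

lemma two_point_homogeneous:
  assumes dist_eq: "dist_E a b = dist_E c d" and type_eq: "a \<in> Vp \<longleftrightarrow> c \<in> Vp"
  shows "\<exists>g\<in>Aut E. g a = c \<and> g b = d"
proof -
  \<comment> \<open>What must be known about the image of a vertex in order to match up the children.\<close>
  define compat where "compat = (\<lambda>v v'. dist_E c v' = dist_E a v \<and>
    (v' \<in> geodesic c d \<longleftrightarrow> v \<in> geodesic a b))"
  have "\<exists>f. bij_betw f (children a v) (children c v') \<and>
      (\<forall>x\<in>children a v. f x \<in> geodesic c d \<longleftrightarrow> x \<in> geodesic a b)" if "compat v v'" for v v'
  proof (rule bij_betw_matching_subset[OF finite_children finite_children])
    have "v' = c \<longleftrightarrow> v = a" using that gdist_eq_0_iff unfolding compat_def by metis
    moreover have "q_at v' = q_at v"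
      using that Vp_iff_even[of v a] Vp_iff_even[of v' c] type_eq
      unfolding compat_def q_at_def by auto
    ultimately show "card (children a v) = card (children c v')" by (auto simp: card_children)
    show "card (children a v \<inter> geodesic a b) = card (children c v' \<inter> geodesic c d)"
      using that dist_eq unfolding card_children_geodesic compat_def by simp
  qed
  then obtain \<beta> where \<beta>: "\<And>v v'. compat v v' \<Longrightarrow> bij_betw (\<beta> v v') (children a v) (children c v')"
      "\<And>v v' x. compat v v' \<Longrightarrow> x \<in> children a v \<Longrightarrow> \<beta> v v' x \<in> geodesic c d \<longleftrightarrow> x \<in> geodesic a b"
    by metis
  \<comment> \<open>\<open>h n\<close> is the desired map on the sphere of radius \<open>n\<close>, built from the map on the previous sphere.\<close>
  define h where "h = rec_nat (\<lambda>v. c) (\<lambda>n h v. \<beta> (parent a v) (h (parent a v)) v)"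
  define g where "g = (\<lambda>v. h (dist_E a v) v)"
  have ga: "g a = c" by (simp add: g_def h_def)
  have g_child: "g w = \<beta> v (g v) w" if "w \<in> children a v" for v w
    using that parent_child[OF that] by (simp add: g_def h_def children_def)
  have bij_g: "bij_betw g (children a v) (children c (g v))" if "compat v (g v)" for v
    using \<beta>(1)[OF that] by (rule bij_betw_cong[THEN iffD1, rotated]) (simp add: g_child)
  have "dist_E a v = n \<Longrightarrow> compat v (g v)" for v n
  proof (induction n arbitrary: v)
    case 0
    then have "v = a" by simp
    then show ?case using ga by (simp add: compat_def geodesic_def dist_eq)
  next
    case (Suc n)
    then have "v \<noteq> a" by auto
    with parent(2)[of v a] Suc have c: "compat (parent a v) (g (parent a v))" by simp
    have v: "v \<in> children a (parent a v)" using child_of_parent \<open>v \<noteq> a\<close> by auto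
    have "g v \<in> children c (g (parent a v))" using bij_betwE[OF bij_g[OF c]] v by blast
    then have "dist_E c (g v) = dist_E a v"
      using c v by (auto simp: children_def compat_def)
    moreover have "g v \<in> geodesic c d \<longleftrightarrow> v \<in> geodesic a b"
      using \<beta>(2)[OF c v] g_child[OF v] by simp
    ultimately show ?case by (simp add: compat_def)
  qed
  then have compat: "compat v (g v)" for v by blast
  have "g \<in> Aut E"
    using ga compat bij_g by (intro Aut_if_bij_betw_children[of g a c]) (auto simp: compat_def)
  moreover have "g b = d"
    using compat[of b] dist_eq by (auto simp: compat_def geodesic_def)
  ultimately show ?thesis using ga by blast
qed

lemma Aut_inv: assumes "g \<in> Aut E" shows "inv g \<in> Aut E"
proof -
  have b: "bij g" using assms by (auto simp: Aut_def)
  have "E (inv g u) (inv g v) \<longleftrightarrow> E u v" for u v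
    using assms surj_f_inv_f[OF bij_is_surj[OF b]] unfolding Aut_def
    by (metis (mono_tags, lifting) mem_Collect_eq)
  then show ?thesis using bij_imp_bij_inv[OF b] by (simp add: Aut_def)
qed

lemma Aut_comp: "g \<in> Aut E \<Longrightarrow> h \<in> Aut E \<Longrightarrow> g \<circ> h \<in> Aut E"
  by (auto simp: Aut_def intro: bij_comp)

lemma Aut_inv_eq_iff: "g \<in> Aut E \<Longrightarrow> inv g x = y \<longleftrightarrow> g y = x"
  by (auto simp: Aut_def bij_def surj_f_inv_f inv_f_f)

lemma Aut_gdist: assumes "g \<in> Aut E" shows "dist_E (g u) (g v) = dist_E u v"
proof -
  have le: "dist_E (f u) (f v) \<le> dist_E u v" if "f \<in> Aut E" for f u v
  proof -
    have "(E ^^ n) u v \<Longrightarrow> (E ^^ n) (f u) (f v)" for n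
    proof (induction n arbitrary: v)
      case (Suc n)
      then obtain y where "(E ^^ n) u y" "E y v" by (auto elim: relpowp_Suc_E)
      with Suc.IH[of y] that show ?case by (auto simp: Aut_def intro: relpowp_Suc_I)
    qed auto
    then show ?thesis using gdist_le relpowp_gdist by blast
  qed
  have "inv g (g u) = u" "inv g (g v) = v" using assms Aut_inv_eq_iff by auto
  with le[OF Aut_inv[OF assms], of "g u" "g v"] le[OF assms, of u v] show ?thesis by simp
qed

text \<open>Automorphisms preserve degrees, and \<open>qp \<noteq> qm\<close>, so they preserve the bipartition.\<close>

lemma Aut_Vp: assumes "g \<in> Aut E" shows "g v \<in> Vp \<longleftrightarrow> v \<in> Vp"
proof -
  have "bij g" using assms by (simp add: Aut_def)
  have "{w. E (g v) w} = g ` {w. E v w}"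
    using assms \<open>bij g\<close> unfolding Aut_def by (auto simp: image_iff bij_def) (metis surjD)
  then have "card {w. E (g v) w} = card {w. E v w}"
    using \<open>bij g\<close> by (metis bij_is_inj card_image inj_on_subset subset_UNIV)
  then show ?thesis using q_neq by (auto simp: card_neighbours q_at_def split: if_splits)
qed

lemma card_sphere_E:
  assumes "a \<in> Vp" "c \<in> Vp"
  shows "card (sphere_E a n) = card (sphere_E c n)"
proof -
  from assms two_point_homogeneous[of a a c c] obtain g where g: "g \<in> Aut E" "g a = c" by auto
  have "sphere_E c n = g ` sphere_E a n"
  proof (intro set_eqI iffI)
    fix w assume "w \<in> sphere_E c n"
    moreover have "g (inv g w) = w" using Aut_inv_eq_iff[OF g(1)] by blast
    ultimately show "w \<in> g ` sphere_E a n"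
      using Aut_gdist[OF g(1), of a "inv g w"] g(2)
      by (intro image_eqI[of _ _ "inv g w"]) (auto simp: sphere_E_def)
  next
    fix w assume "w \<in> g ` sphere_E a n"
    then show "w \<in> sphere_E c n" using Aut_gdist[OF g(1), of a] g(2) by (auto simp: sphere_E_def)
  qed
  moreover have "inj g" using g by (auto simp: Aut_def bij_def)
  ultimately show ?thesis by (metis card_image inj_on_subset subset_UNIV)
qed

lemma countable_V: "countable (UNIV :: 'v set)"
proof -
  have "(UNIV :: 'v set) = (\<Union>n. sphere_E undefined n)" by (auto simp: sphere_E_def)
  then show ?thesis using finite_sphere_E by (metis countable_UN uncountable_infinite countableI_type)
qed

section \<open>Sphere sums of eigenfunctions\<close>

lemma neighbour_sum:
  fixes \<Phi> :: "'v \<Rightarrow> complex"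
  shows "(\<Sum>z | E y z. \<Phi> z) =
    (\<Sum>z\<in>children r y. \<Phi> z) + (if y = r then 0 else \<Phi> (parent r y))"
  using finite_children[of r y] parent_not_child[of y r]
  unfolding neighbours_eq[of y r] by (auto simp: algebra_simps)

lemma sum_sphere_children:
  fixes F :: "'v \<Rightarrow> complex"
  shows "(\<Sum>y\<in>sphere_E r n. \<Sum>z\<in>children r y. F z) = (\<Sum>z\<in>sphere_E r (Suc n). F z)"
  unfolding sphere_E_Suc
  by (rule sum.UNION_disjoint[symmetric])
     (use finite_sphere_E finite_children children_disjoint in auto)

definition q_level :: "nat \<Rightarrow> nat" where
  "q_level n = (if even n then qp else qm)"

lemma q_at_sphere: "r \<in> Vp \<Longrightarrow> v \<in> sphere_E r n \<Longrightarrow> q_at v = q_level n"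
  using Vp_iff_even[of v r] by (auto simp: q_at_def q_level_def sphere_E_def)

lemma is_sphericalD:
  assumes "is_spherical E Vp qp qm v0 \<gamma> \<Phi>"
  shows "laplace E Vp qp qm \<Phi> y = \<gamma> * \<Phi> y" "\<Phi> v0 = 1"
    "dist_E v0 y = dist_E v0 x \<Longrightarrow> \<Phi> y = \<Phi> x"
  using assms unfolding is_spherical_def by blast+

lemma is_spherical_neighbour_sum:
  assumes "is_spherical E Vp qp qm v0 \<gamma> \<Phi>"
  shows "(\<Sum>z | E y z. \<Phi> z) = \<gamma> * of_nat (Suc (q_at y)) * \<Phi> y"
proof -
  have "(\<Sum>z | E y z. \<Phi> z) / of_nat (Suc (q_at y)) = \<gamma> * \<Phi> y"
    using is_sphericalD(1)[OF assms, of y] by (simp add: laplace_def q_at_def)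
  then show ?thesis by (simp add: divide_eq_eq mult_ac del: of_nat_Suc)
qed

text \<open>Radius one is special since the centre, unlike every other vertex, has no parent: this gives
  the exceptional initial coefficient in the recursion for the sphere sums.\<close>

lemma sphere_sum_1:
  assumes sph: "is_spherical E Vp qp qm v0 \<gamma> \<Phi>" and r: "r \<in> Vp"
  shows "(\<Sum>z\<in>sphere_E r 1. \<Phi> z) = \<gamma> * of_nat (Suc qp) * \<Phi> r"
  using is_spherical_neighbour_sum[OF sph, of r] neighbour_sum[of \<Phi> r r] r
    sum_sphere_children[of \<Phi> r 0]
  by (simp add: sphere_E_0 q_at_def)

text \<open>Sum the eigenvalue equation over the sphere of radius \<open>n + 1\<close>. Every vertex of radius \<open>n + 2\<close> is
  a neighbour of exactly one summation point, and a vertex of radius \<open>n\<close> is one as often as it has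
  children.\<close>

lemma sphere_sum_Suc_Suc:
  assumes sph: "is_spherical E Vp qp qm v0 \<gamma> \<Phi>" and r: "r \<in> Vp"
  shows "(\<Sum>z\<in>sphere_E r (Suc (Suc n)). \<Phi> z) =
    \<gamma> * of_nat (Suc (q_level (Suc n))) * (\<Sum>z\<in>sphere_E r (Suc n). \<Phi> z)
    - of_nat (if n = 0 then Suc qp else q_level n) * (\<Sum>z\<in>sphere_E r n. \<Phi> z)"
proof -
  have "(\<Sum>y\<in>sphere_E r (Suc n). \<Phi> (parent r y))
      = (\<Sum>z\<in>sphere_E r n. \<Sum>y\<in>children r z. \<Phi> (parent r y))"
    by (rule sum_sphere_children[symmetric])
  also have "\<dots> = (\<Sum>z\<in>sphere_E r n. of_nat (if n = 0 then Suc qp else q_level n) * \<Phi> z)"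
  proof (intro sum.cong refl)
    fix z assume z: "z \<in> sphere_E r n"
    have "z = r \<longleftrightarrow> n = 0" using z by (auto simp: sphere_E_def)
    then have "card (children r z) = (if n = 0 then Suc qp else q_level n)"
      using q_at_sphere[OF r z] by (auto simp: card_children q_level_def)
    then show "(\<Sum>y\<in>children r z. \<Phi> (parent r y)) =
        of_nat (if n = 0 then Suc qp else q_level n) * \<Phi> z"
      by (simp add: parent_child del: of_nat_Suc)
  qed
  finally have parents: "(\<Sum>y\<in>sphere_E r (Suc n). \<Phi> (parent r y)) =
      of_nat (if n = 0 then Suc qp else q_level n) * (\<Sum>z\<in>sphere_E r n. \<Phi> z)"
    by (simp only: sum_distrib_left)
  have "\<gamma> * of_nat (Suc (q_level (Suc n))) * (\<Sum>z\<in>sphere_E r (Suc n). \<Phi> z)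
      = (\<Sum>y\<in>sphere_E r (Suc n). \<Sum>z | E y z. \<Phi> z)"
    unfolding sum_distrib_left
    by (intro sum.cong refl) (simp add: is_spherical_neighbour_sum[OF sph] q_at_sphere[OF r])
  also have "\<dots> = (\<Sum>y\<in>sphere_E r (Suc n). (\<Sum>z\<in>children r y. \<Phi> z) + \<Phi> (parent r y))"
    by (intro sum.cong refl) (auto simp: neighbour_sum[of _ _ r] sphere_E_def)
  also have "\<dots> = (\<Sum>z\<in>sphere_E r (Suc (Suc n)). \<Phi> z) +
      of_nat (if n = 0 then Suc qp else q_level n) * (\<Sum>z\<in>sphere_E r n. \<Phi> z)"
    by (simp only: sum.distrib sum_sphere_children parents)
  finally show ?thesis by simp
qed

text \<open>The recursion is the same for every centre in \<open>Vp\<close>, and its two initial values are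
  proportional to the value at the centre.\<close>

lemma sphere_sum_eq:
  assumes sph: "is_spherical E Vp qp qm v0 \<gamma> \<Phi>" and v0: "v0 \<in> Vp" and w: "w \<in> Vp"
  shows "(\<Sum>z\<in>sphere_E w n. \<Phi> z) = (\<Sum>z\<in>sphere_E v0 n. \<Phi> z) * \<Phi> w"
proof -
  note one = is_sphericalD(2)[OF sph]
  show ?thesis
  proof (induction n rule: induct_nat_012)
    case 1
    then show ?case
      using sphere_sum_1[OF sph v0] sphere_sum_1[OF sph w] by (simp add: one)
  next
    case (ge2 n)
    then show ?case
      unfolding sphere_sum_Suc_Suc[OF sph v0] sphere_sum_Suc_Suc[OF sph w]
      by (simp add: algebra_simps)
  qed (simp add: sphere_E_0 one)
qed

lemma spherical_functional_equation:
  assumes sph: "is_spherical E Vp qp qm v0 \<gamma> \<Phi>" and v0: "v0 \<in> Vp" and w: "w \<in> Vp"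
  shows "(\<Sum>y\<in>sphere_E w (dist_E v0 x). \<Phi> y) =
    of_nat (card (sphere_E v0 (dist_E v0 x))) * (\<Phi> w * \<Phi> x)"
proof -
  have "\<Phi> y = \<Phi> x" if "y \<in> sphere_E v0 (dist_E v0 x)" for y
    using is_sphericalD(3)[OF sph, of y x] that by (simp add: sphere_E_def)
  then show ?thesis
    using sphere_sum_eq[OF sph v0 w, of "dist_E v0 x"] by simp
qed

end

section \<open>Haar measure on the automorphism group\<close>

locale haar_tree = semihomogeneous +
  fixes v0 :: 'a and M :: "('a \<Rightarrow> 'a) measure"
  assumes v0: "v0 \<in> Vp" and haar: "normalized_haar E v0 M"
begin

definition maps :: "'a \<Rightarrow> 'a \<Rightarrow> ('a \<Rightarrow> 'a) set" where
  "maps x w = {\<tau> \<in> Aut E. \<tau> x = w}"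

lemma space_M: "space M = Aut E"
  using haar by (simp add: normalized_haar_def)

lemma maps_sets [measurable]: "maps x w \<in> sets M"
proof -
  have "openin (product_topology (\<lambda>_. discrete_topology UNIV) UNIV) {\<tau>. \<tau> x = w}"
    using openin_continuous_map_preimage[OF continuous_map_product_projection[of x UNIV
        "\<lambda>_. discrete_topology (UNIV :: 'a set)"], of "{w}"] by simp
  then have "openin (Aut_topology E) ({\<tau>. \<tau> x = w} \<inter> Aut E)"
    unfolding Aut_topology_def by (rule openin_subtopology_Int)
  moreover have "{\<tau>. \<tau> x = w} \<inter> Aut E = maps x w" by (auto simp: maps_def)
  ultimately show ?thesis using haar by (auto simp: normalized_haar_def)
qed

lemma emeasure_maps_translate:
  assumes g: "g \<in> Aut E"
  shows "emeasure M (maps x (g w) \<inter> maps z (g y)) = emeasure M (maps x w \<inter> maps z y)"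
proof -
  have "(\<lambda>h. g \<circ> h) ` (maps x w \<inter> maps z y) = maps x (g w) \<inter> maps z (g y)"
  proof (intro set_eqI iffI)
    fix \<tau> assume \<tau>: "\<tau> \<in> maps x (g w) \<inter> maps z (g y)"
    have "g \<circ> (inv g \<circ> \<tau>) = \<tau>"
      using g by (auto simp: fun_eq_iff Aut_def bij_def surj_f_inv_f)
    moreover have "inv g \<circ> \<tau> \<in> maps x w \<inter> maps z y"
      using \<tau> g Aut_comp[OF Aut_inv[OF g]] by (auto simp: maps_def Aut_inv_eq_iff)
    ultimately show "\<tau> \<in> (\<lambda>h. g \<circ> h) ` (maps x w \<inter> maps z y)" by (metis imageI)
  next
    fix \<tau> assume "\<tau> \<in> (\<lambda>h. g \<circ> h) ` (maps x w \<inter> maps z y)"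
    then show "\<tau> \<in> maps x (g w) \<inter> maps z (g y)" using g Aut_comp by (auto simp: maps_def)
  qed
  moreover have "\<forall>g\<in>Aut E. \<forall>A\<in>sets M. emeasure M ((\<lambda>h. g \<circ> h) ` A) = emeasure M A"
    using haar by (simp add: normalized_haar_def)
  ultimately show ?thesis using g by (metis maps_sets sets.Int)
qed

lemma maps_Un_sphere: "maps z y = (\<Union>w\<in>sphere_E y (dist_E z x). maps x w \<inter> maps z y)"
  by (auto simp: maps_def sphere_E_def Aut_gdist)

lemma emeasure_maps_sum:
  "emeasure M (maps z y) = (\<Sum>w\<in>sphere_E y (dist_E z x). emeasure M (maps x w \<inter> maps z y))"
proof -
  have "(\<Sum>w\<in>sphere_E y (dist_E z x). emeasure M (maps x w \<inter> maps z y))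
      = emeasure M (\<Union>w\<in>sphere_E y (dist_E z x). maps x w \<inter> maps z y)"
    by (rule sum_emeasure)
       (auto simp: disjoint_family_on_def maps_def finite_sphere_E
             intro: maps_sets[unfolded maps_def] sets.Int)
  then show ?thesis using maps_Un_sphere[of z y x] by simp
qed

text \<open>The stabilizer of \<open>v0\<close>, which has mass one, splits according to the image of \<open>x\<close>, and two-point
  homogeneity together with left invariance makes all pieces equally large, also after moving the
  pair \<open>(u, v0)\<close> to an arbitrary pair \<open>(w, y)\<close> at the same distance.\<close>

lemma emeasure_two_point:
  assumes x: "x \<in> Vp" and w: "w \<in> Vp" and y: "y \<in> sphere_E w (dist_E v0 x)"
  shows "of_nat (card (sphere_E v0 (dist_E v0 x))) * emeasure M (maps x w \<inter> maps v0 y) = 1"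
proof -
  have "emeasure M (maps x u \<inter> maps v0 v0) = emeasure M (maps x w \<inter> maps v0 y)"
    if u: "u \<in> sphere_E v0 (dist_E v0 x)" for u
  proof -
    have "u \<in> Vp" using u x v0 Vp_iff_even[of u v0] Vp_iff_even[of x v0]
      by (simp add: sphere_E_def)
    then obtain g where "g \<in> Aut E" "g u = w" "g v0 = y"
      using two_point_homogeneous[of u v0 w y] u y w v0 gdist_sym[of u v0]
      by (auto simp: sphere_E_def)
    then show ?thesis using emeasure_maps_translate[of g x u v0 v0] by simp
  qed
  moreover have "emeasure M (maps v0 v0) = 1"
    using haar by (simp add: normalized_haar_def stab_def maps_def)
  ultimately show ?thesis using emeasure_maps_sum[of v0 v0 x] by simp
qed

text \<open>This is where unimodularity would usually enter, because the set is a left translate of the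
  stabilizer of \<open>x\<close> rather than of that of \<open>v0\<close>. Here it splits by the image of \<open>v0\<close> into as many
  pieces as the stabilizer of \<open>v0\<close> splits by the image of \<open>x\<close>, all of the same size.\<close>

lemma emeasure_maps:
  assumes "x \<in> Vp" "w \<in> Vp"
  shows "emeasure M (maps x w) = 1"
proof -
  have "sphere_E v0 (dist_E v0 x) \<noteq> {}" by (auto simp: sphere_E_def)
  then have ne: "card (sphere_E w (dist_E v0 x)) \<noteq> 0"
    using card_sphere_E[OF assms(2) v0] finite_sphere_E by (metis card_0_eq)
  then obtain y where y: "y \<in> sphere_E w (dist_E v0 x)" by fastforce
  have const: "emeasure M (maps x w \<inter> maps v0 y') = emeasure M (maps x w \<inter> maps v0 y)"
    if y': "y' \<in> sphere_E w (dist_E v0 x)" for y'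
  proof -
    obtain g where "g \<in> Aut E" "g w = w" "g y = y'"
      using two_point_homogeneous[of w y w y'] y y' by (auto simp: sphere_E_def)
    then show ?thesis using emeasure_maps_translate[of g x w v0 y] by simp
  qed
  have "emeasure M (maps x w) = (\<Sum>y'\<in>sphere_E w (dist_E v0 x). emeasure M (maps x w \<inter> maps v0 y'))"
    using emeasure_maps_sum[of x w v0] by (simp add: Int_commute gdist_sym)
  also have "\<dots> = of_nat (card (sphere_E w (dist_E v0 x))) * emeasure M (maps x w \<inter> maps v0 y)"
    by (simp add: const)
  finally show ?thesis
    using emeasure_two_point[OF assms y] card_sphere_E[OF assms(2) v0] by simp
qed

lemma measure_two_point:
  assumes "x \<in> Vp" "w \<in> Vp" "y \<in> sphere_E w (dist_E v0 x)"
  shows "measure M (maps x w \<inter> maps v0 y) = 1 / card (sphere_E v0 (dist_E v0 x))"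
proof -
  let ?k = "card (sphere_E v0 (dist_E v0 x))"
  have "real ?k * measure M (maps x w \<inter> maps v0 y) = 1"
    using arg_cong[OF emeasure_two_point[OF assms], of enn2real]
    by (simp add: enn2real_mult measure_def)
  then show ?thesis by (metis eq_divide_eq mult.commute mult_zero_left zero_neq_one)
qed

text \<open>For \<open>\<tau>\<close> distributed over the automorphisms that take \<open>x\<close> to \<open>w\<close>, the vertex \<open>\<tau> v0\<close> is
  uniformly distributed on a sphere about \<open>w\<close>. The values of \<open>h\<close> lie in a general space because
  the lemma serves both the complex integrals and the real integrals of their norms.\<close>

lemma has_bochner_integral_maps:
  fixes h :: "'a \<Rightarrow> 'b :: {banach, second_countable_topology}"
  assumes x: "x \<in> Vp" and w: "w \<in> Vp"
  shows "has_bochner_integral M (\<lambda>\<tau>. indicator (maps x w) \<tau> *\<^sub>R h (\<tau> v0))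
    ((\<Sum>y\<in>sphere_E w (dist_E v0 x). h y) /\<^sub>R card (sphere_E v0 (dist_E v0 x)))"
proof -
  let ?S = "sphere_E w (dist_E v0 x)"
  have "has_bochner_integral M (\<lambda>\<tau>. \<Sum>y\<in>?S. indicator (maps x w \<inter> maps v0 y) \<tau> *\<^sub>R h y)
      (\<Sum>y\<in>?S. measure M (maps x w \<inter> maps v0 y) *\<^sub>R h y)"
  proof (intro has_bochner_integral_sum has_bochner_integral_indicator)
    fix y
    have "emeasure M (maps x w \<inter> maps v0 y) \<le> emeasure M (maps x w)"
      by (rule emeasure_mono) auto
    then show "emeasure M (maps x w \<inter> maps v0 y) < \<infinity>"
      using emeasure_maps[OF x w] by (simp add: order_le_less_trans)
  qed auto
  moreover have "(\<Sum>y\<in>?S. measure M (maps x w \<inter> maps v0 y) *\<^sub>R h y)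
      = (\<Sum>y\<in>?S. h y) /\<^sub>R card (sphere_E v0 (dist_E v0 x))"
    unfolding scaleR_sum_right
    by (intro sum.cong refl) (simp add: measure_two_point[OF x w] divide_inverse)
  moreover have "(\<Sum>y\<in>?S. indicator (maps x w \<inter> maps v0 y) \<tau> *\<^sub>R h y)
      = indicator (maps x w) \<tau> *\<^sub>R h (\<tau> v0)" if "\<tau> \<in> space M" for \<tau>
  proof (cases "\<tau> \<in> maps x w")
    case True
    then have "\<tau> v0 \<in> ?S"
      using Aut_gdist[of \<tau> x v0] gdist_sym[of x v0] by (auto simp: maps_def sphere_E_def)
    have "(\<Sum>y\<in>?S. indicator (maps x w \<inter> maps v0 y) \<tau> *\<^sub>R h y)
        = (\<Sum>y\<in>?S. if \<tau> v0 = y then h y else 0)"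
      using True by (intro sum.cong refl) (auto simp: indicator_def maps_def)
    also have "\<dots> = h (\<tau> v0)" using \<open>\<tau> v0 \<in> ?S\<close> by (simp add: finite_sphere_E)
    finally show ?thesis using True by simp
  qed auto
  ultimately show ?thesis
    using has_bochner_integral_cong[of M M] by (metis (no_types, lifting))
qed

lemma countable_Vp: "countable Vp"
  by (rule countable_subset[OF subset_UNIV countable_V])

text \<open>The Haar measure projects to the counting measure on the orbit of \<open>v0\<close>; this identifies
  right-invariant functions on the group with functions on \<open>Vp\<close>.\<close>

lemma distr_orbit_map: "distr M (count_space Vp) (\<lambda>\<tau>. \<tau> v0) = count_space Vp"
  and measurable_orbit_map: "(\<lambda>\<tau>. \<tau> v0) \<in> measurable M (count_space Vp)"
proof -
  have pre: "(\<lambda>\<tau>. \<tau> v0) -` {w} \<inter> space M = maps v0 w" for w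
    by (auto simp: maps_def space_M)
  show meas: "(\<lambda>\<tau>. \<tau> v0) \<in> measurable M (count_space Vp)"
    by (subst measurable_count_space_eq_countable)
       (auto simp: countable_Vp space_M Aut_Vp v0 pre[unfolded space_M])
  show "distr M (count_space Vp) (\<lambda>\<tau>. \<tau> v0) = count_space Vp"
    by (rule measure_eqI_countable[where A = Vp])
       (auto simp: countable_Vp emeasure_distr[OF meas] pre emeasure_maps[OF v0])
qed

lemma integral_orbit:
  fixes h :: "'a \<Rightarrow> complex"
  shows "(LINT \<tau>|M. h (\<tau> v0)) = infsetsum h Vp"
  using integral_distr[OF measurable_orbit_map, of h] by (simp add: distr_orbit_map infsetsum_def)

lemma sigma_finite_M: "sigma_finite_measure M"
proof
  show "\<exists>A. countable A \<and> A \<subseteq> sets M \<and> \<Union> A = space M \<and> (\<forall>a\<in>A. emeasure M a \<noteq> \<infinity>)"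
    using emeasure_maps[OF v0] Aut_Vp v0
    by (intro exI[of _ "maps v0 ` Vp"])
       (auto simp: countable_Vp space_M maps_def intro: maps_sets[unfolded maps_def])
qed

lemma convol_involution_eq:
  assumes "\<tau> \<in> Aut E"
  shows "convol M (involution (lift_fun v0 f)) (lift_fun v0 f) \<tau>
    = infsetsum (\<lambda>w. f w * cnj (f (inv \<tau> w))) Vp"
proof -
  have "inv (inv l \<circ> \<tau>) v0 = inv \<tau> (l v0)" if l: "l \<in> Aut E" for l
  proof -
    have "\<tau> (inv \<tau> (l v0)) = l v0" using Aut_inv_eq_iff[OF assms] by blast
    moreover have "inv l (l v0) = v0" using Aut_inv_eq_iff[OF l] by blast
    ultimately show ?thesis using Aut_inv_eq_iff[OF Aut_comp[OF Aut_inv[OF l] assms]] by simp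
  qed
  then have "convol M (involution (lift_fun v0 f)) (lift_fun v0 f) \<tau>
      = (LINT l|M. (\<lambda>w. f w * cnj (f (inv \<tau> w))) (l v0))"
    unfolding convol_def involution_def lift_fun_def
    by (intro Bochner_Integration.integral_cong refl) (simp add: space_M)
  then show ?thesis using integral_orbit[of "\<lambda>w. f w * cnj (f (inv \<tau> w))"] by simp
qed

text \<open>The convolution at \<open>\<tau>\<close> is a sum over \<open>w\<close> in which \<open>f\<close> is also evaluated at the preimage \<open>x\<close> of \<open>w\<close>.
  Treating \<open>x\<close> as a second summation variable, constrained by an indicator function to be that
  preimage, decouples the sums from \<open>\<tau>\<close>, and Fubini's theorem leaves the sphere means to be
  summed.\<close>

lemma L_G_convol:
  fixes f h :: "'a \<Rightarrow> complex"
  assumes f: "f abs_summable_on Vp" and B: "\<forall>v\<in>Vp. norm (h v) \<le> B"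
  defines "u \<equiv> convol M (involution (lift_fun v0 f)) (lift_fun v0 f)"
  shows "L_defined_G M v0 h u"
    and "L_G M v0 h u = infsetsum (\<lambda>(w, x). f w * cnj (f x) *
           ((\<Sum>y\<in>sphere_E w (dist_E v0 x). h y) / card (sphere_E v0 (dist_E v0 x)))) (Vp \<times> Vp)"
proof -
  define P where "P = count_space (Vp \<times> Vp)"
  define g where "g = (\<lambda>(w, x) \<tau>. indicator (maps x w) \<tau> *\<^sub>R (f w * cnj (f x) * h (\<tau> v0)))"
  have cP: "countable (Vp \<times> Vp)" using countable_Vp by blast
  interpret pair_sigma_finite P M
    unfolding P_def
    by (intro pair_sigma_finite.intro sigma_finite_measure_count_space_countable sigma_finite_M cP)
  have g_int: "has_bochner_integral M (g (w, x)) (f w * cnj (f x) *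
      ((\<Sum>y\<in>sphere_E w (dist_E v0 x). h y) / card (sphere_E v0 (dist_E v0 x))))"
    if "w \<in> Vp" "x \<in> Vp" for w x
    using has_bochner_integral_maps[OF that(2,1), of "\<lambda>y. f w * cnj (f x) * h y"]
    unfolding sum_distrib_left[symmetric]
    by (simp add: g_def scaleR_conv_of_real divide_inverse mult_ac)
  have norm_g: "(LINT \<tau>|M. norm (g (w, x) \<tau>)) \<le> norm (f w) * norm (f x) * B"
    if "w \<in> Vp" "x \<in> Vp" for w x
  proof -
    let ?S = "sphere_E w (dist_E v0 x)"
    let ?k = "card (sphere_E v0 (dist_E v0 x))"
    have "?k \<noteq> 0" using finite_sphere_E by (auto simp: sphere_E_def)
    have "(\<Sum>y\<in>?S. norm (h y)) \<le> (\<Sum>y\<in>?S. B)"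
      using B sphere_E_subset_Vp[OF v0 that(2,1)] by (intro sum_mono) auto
    also have "\<dots> = ?k * B" using card_sphere_E[OF that(1) v0] by simp
    finally have avg: "(\<Sum>y\<in>?S. norm (h y)) / ?k \<le> B"
      using \<open>?k \<noteq> 0\<close> by (simp add: divide_le_eq mult.commute)
    have "(LINT \<tau>|M. norm (g (w, x) \<tau>)) = norm (f w) * norm (f x) * ((\<Sum>y\<in>?S. norm (h y)) / ?k)"
      using has_bochner_integral_integral_eq[OF has_bochner_integral_maps[OF that(2,1),
          of "\<lambda>y. norm (f w * cnj (f x) * h y)"]]
      by (simp add: g_def norm_mult sum_distrib_left[symmetric] divide_inverse mult_ac)
    also have "\<dots> \<le> norm (f w) * norm (f x) * B"
      by (rule mult_left_mono[OF avg]) simp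
    finally show ?thesis .
  qed
  have g_prod: "integrable (P \<Otimes>\<^sub>M M) (case_prod g)"
  proof (rule Fubini_integrable)
    show "case_prod g \<in> borel_measurable (P \<Otimes>\<^sub>M M)"
      unfolding P_def using g_int
      by (intro measurable_pair_measure_countable1 cP)
         (auto simp: has_bochner_integral_iff intro: borel_measurable_integrable)
    have "(\<lambda>(w, x). norm (f w) * norm (f x)) abs_summable_on (Vp \<times> Vp)"
      using f countable_Vp by (intro abs_summable_on_product) auto
    then have "(\<lambda>p. (case p of (w, x) \<Rightarrow> norm (f w) * norm (f x)) * B) abs_summable_on (Vp \<times> Vp)"
      by (intro abs_summable_on_cmult_left)
    then have "(\<lambda>p. LINT \<tau>|M. norm (g p \<tau>)) abs_summable_on (Vp \<times> Vp)"
      by (rule abs_summable_on_comparison_test') (use norm_g in auto)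
    then show "integrable P (\<lambda>p. LINT \<tau>|M. norm (case_prod g (p, \<tau>)))"
      by (simp add: abs_summable_on_def P_def)
    show "AE p in P. integrable M (\<lambda>\<tau>. case_prod g (p, \<tau>))"
      using g_int by (auto simp: P_def AE_count_space has_bochner_integral_iff)
  qed
  have slice: "(LINT p|P. g p \<tau>) = u \<tau> * h (\<tau> v0)" if "\<tau> \<in> space M" for \<tau>
  proof -
    have \<tau>: "\<tau> \<in> Aut E" using that by (simp add: space_M)
    have inverse: "\<tau> (inv \<tau> x) = x" "inv \<tau> (\<tau> x) = x" for x
      using Aut_inv_eq_iff[OF \<tau>] by blast+
    let ?graph = "(\<lambda>w. (w, inv \<tau> w)) ` Vp"
    have "(LINT p|P. g p \<tau>) = infsetsum (\<lambda>(w, x). f w * cnj (f x) * h (\<tau> v0)) ?graph"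
      unfolding P_def infsetsum_def[symmetric]
      by (rule infsetsum_cong_neutral)
         (use \<tau> Aut_Vp[OF Aut_inv[OF \<tau>]]
           in \<open>auto simp: g_def maps_def indicator_def image_iff inverse\<close>)
    also have "\<dots> = infsetsum (\<lambda>w. f w * cnj (f (inv \<tau> w)) * h (\<tau> v0)) Vp"
      using infsetsum_reindex_bij_betw[of "\<lambda>w. (w, inv \<tau> w)" Vp ?graph
          "\<lambda>(w, x). f w * cnj (f x) * h (\<tau> v0)"]
      by (simp add: bij_betw_def inj_on_def)
    also have "\<dots> = infsetsum (\<lambda>w. f w * cnj (f (inv \<tau> w))) Vp * h (\<tau> v0)"
      by (simp add: infsetsum_def)
    finally show ?thesis unfolding u_def convol_involution_eq[OF \<tau>] .
  qed
  have "integrable M (\<lambda>\<tau>. LINT p|P. g p \<tau>)"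
    using integrable_snd[OF g_prod] .
  then show "L_defined_G M v0 h u"
    unfolding L_defined_G_def by (subst Bochner_Integration.integrable_cong[OF refl slice[symmetric]])
  have "L_G M v0 h u = (LINT \<tau>|M. LINT p|P. g p \<tau>)"
    unfolding L_G_def by (intro Bochner_Integration.integral_cong refl) (simp add: slice)
  also have "\<dots> = (LINT p|P. LINT \<tau>|M. g p \<tau>)"
    by (rule Fubini_integral[OF g_prod])
  also have "\<dots> = infsetsum (\<lambda>(w, x). f w * cnj (f x) *
           ((\<Sum>y\<in>sphere_E w (dist_E v0 x). h y) / card (sphere_E v0 (dist_E v0 x)))) (Vp \<times> Vp)"
    unfolding P_def infsetsum_def
    by (intro Bochner_Integration.integral_cong refl)
       (auto simp: has_bochner_integral_integral_eq[OF g_int])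
  finally show "L_G M v0 h u = infsetsum (\<lambda>(w, x). f w * cnj (f x) *
           ((\<Sum>y\<in>sphere_E w (dist_E v0 x). h y) / card (sphere_E v0 (dist_E v0 x)))) (Vp \<times> Vp)" .
qed

section \<open>The functional on spherical functions\<close>

lemma abs_summable_mult_bounded:
  fixes f \<phi> :: "'a \<Rightarrow> complex"
  assumes "f abs_summable_on Vp" and B: "\<forall>v\<in>Vp. norm (\<phi> v) \<le> B"
  shows "(\<lambda>v. f v * \<phi> v) abs_summable_on Vp"
proof -
  have "(\<lambda>v. norm (f v) * B) abs_summable_on Vp"
    using assms(1) by (intro abs_summable_on_cmult_left) simp
  then show ?thesis
    by (rule abs_summable_on_comparison_test') (use B in \<open>auto simp: norm_mult intro: mult_left_mono\<close>)
qed

lemma L_G_spherical: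
  fixes f \<phi> :: "'a \<Rightarrow> complex"
  assumes sph: "spherical_on_Vp E Vp qp qm v0 \<phi>"
    and f: "f abs_summable_on Vp" and B: "\<forall>v\<in>Vp. norm (\<phi> v) \<le> B"
  shows "L_G M v0 \<phi> (convol M (involution (lift_fun v0 f)) (lift_fun v0 f))
    = infsetsum (\<lambda>v. f v * \<phi> v) Vp * infsetsum (\<lambda>v. cnj (f v) * \<phi> v) Vp"
proof -
  obtain \<gamma> \<Phi> where \<Phi>: "is_spherical E Vp qp qm v0 \<gamma> \<Phi>" and eq: "\<And>v. v \<in> Vp \<Longrightarrow> \<phi> v = \<Phi> v"
    using sph by (auto simp: spherical_on_Vp_def)
  have avg: "(\<Sum>y\<in>sphere_E w (dist_E v0 x). \<phi> y) / card (sphere_E v0 (dist_E v0 x)) = \<phi> w * \<phi> x"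
    if "w \<in> Vp" "x \<in> Vp" for w x
  proof -
    have "(\<Sum>y\<in>sphere_E w (dist_E v0 x). \<phi> y) = (\<Sum>y\<in>sphere_E w (dist_E v0 x). \<Phi> y)"
      using sphere_E_subset_Vp[OF v0 that(2,1)] by (intro sum.cong refl) (auto simp: eq)
    moreover have "card (sphere_E v0 (dist_E v0 x)) \<noteq> 0"
      using finite_sphere_E by (auto simp: sphere_E_def)
    ultimately show ?thesis
      using spherical_functional_equation[OF \<Phi> v0 that(1), of x] that by (simp add: eq)
  qed
  have "L_G M v0 \<phi> (convol M (involution (lift_fun v0 f)) (lift_fun v0 f))
      = infsetsum (\<lambda>(w, x). (f w * \<phi> w) * (cnj (f x) * \<phi> x)) (Vp \<times> Vp)"
    unfolding L_G_convol(2)[OF f B]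
    by (intro infsetsum_cong refl) (auto simp: avg mult_ac simp del: times_divide_eq_right)
  also have "\<dots> = infsetsum (\<lambda>v. f v * \<phi> v) Vp * infsetsum (\<lambda>v. cnj (f v) * \<phi> v) Vp"
  proof (rule infsetsum_product)
    show "(\<lambda>v. f v * \<phi> v) abs_summable_on Vp" using f B by (rule abs_summable_mult_bounded)
    have "(\<lambda>v. cnj (f v)) abs_summable_on Vp"
      using f abs_summable_on_norm_iff[of "\<lambda>v. cnj (f v)"] abs_summable_on_norm_iff[of f] by simp
    then show "(\<lambda>v. cnj (f v) * \<phi> v) abs_summable_on Vp" using B by (rule abs_summable_mult_bounded)
  qed (simp_all add: countable_Vp)
  finally show ?thesis .
qed

end

lemma infsetsum_two_points:
  fixes f :: "'a \<Rightarrow> complex"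
  assumes "a \<in> A" "b \<in> A" "a \<noteq> b" "\<And>x. x \<in> A \<Longrightarrow> x \<noteq> a \<Longrightarrow> x \<noteq> b \<Longrightarrow> f x = 0"
  shows "infsetsum f A = f a + f b"
proof -
  have "infsetsum f A = infsetsum f {a, b}"
    using assms by (intro infsetsum_cong_neutral) auto
  then show ?thesis using assms by simp
qed

text \<open>At \<open>t = 1\<close> the square is seen to be real, so \<open>z\<close> is real or purely imaginary; in the second case a
  large \<open>t\<close> makes the expression negative.\<close>

lemma real_if_one_plus_square_nonneg:
  fixes z :: complex
  assumes "\<And>t::real. 1 + of_real (t\<^sup>2) * z\<^sup>2 \<in> \<real>\<^sub>\<ge>\<^sub>0"
  shows "z \<in> \<real>"
proof -
  have "1 + z\<^sup>2 \<in> \<real>\<^sub>\<ge>\<^sub>0" using assms[of 1] by simp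
  then have "Im (1 + z\<^sup>2) = 0" by (simp only: complex_nonneg_Reals_iff)
  then have im: "Re z * Im z = 0" by (auto simp: power2_eq_square)
  have "Im z = 0"
  proof (rule ccontr)
    assume nz: "Im z \<noteq> 0"
    with im have "Re z = 0" by simp
    then have "z\<^sup>2 = of_real (- (Im z)\<^sup>2)" by (simp add: complex_eq_iff power2_eq_square)
    then have "1 + of_real ((2 / Im z)\<^sup>2) * z\<^sup>2 = (of_real (1 + (2 / Im z)\<^sup>2 * - (Im z)\<^sup>2) :: complex)"
      by simp
    also have "(2 / Im z)\<^sup>2 * - (Im z)\<^sup>2 = -4" using nz by (simp add: power_divide)
    finally have "(of_real (1 + -4) :: complex) \<in> \<real>\<^sub>\<ge>\<^sub>0" using assms[of "2 / Im z"] by metis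
    then show False by (simp only: nonneg_Reals_of_real_iff)
  qed
  then show ?thesis by (simp add: complex_is_Real_iff)
qed

text \<open>If \<open>\<phi>\<close> exceeds \<open>2 ^ n\<close> at points \<open>s n\<close>, the function with value \<open>1 / 2 ^ n\<close> at \<open>s n\<close> is summable
  but its product with \<open>\<phi>\<close> does not even tend to zero. Choosing the absolute values of \<open>\<phi>\<close> along
  \<open>s\<close> strictly increasing keeps the points distinct.\<close>

lemma bounded_if_summable_against_ell1:
  fixes \<phi> :: "'v \<Rightarrow> complex"
  assumes summ: "\<And>f. f \<in> ell1 A \<Longrightarrow> (\<lambda>v. f v * \<phi> v) summable_on A"
  shows "bounded (\<phi> ` A)"
proof (rule ccontr)
  assume "\<not> bounded (\<phi> ` A)"
  then have big: "\<exists>v\<in>A. norm (\<phi> v) > C" for C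
    unfolding bounded_iff by (metis imageE not_le)
  have "\<exists>s. \<forall>n. (s n \<in> A \<and> norm (\<phi> (s n)) > 2 ^ n) \<and> norm (\<phi> (s (Suc n))) > norm (\<phi> (s n))"
  proof (rule dependent_nat_choice)
    show "\<exists>x. x \<in> A \<and> norm (\<phi> x) > 2 ^ 0" using big by blast
    show "\<exists>y. (y \<in> A \<and> norm (\<phi> y) > 2 ^ Suc n) \<and> norm (\<phi> y) > norm (\<phi> x)" for x n
      using big[of "max (2 ^ Suc n) (norm (\<phi> x))"] by auto
  qed
  then obtain s where s: "\<And>n. s n \<in> A" "\<And>n. norm (\<phi> (s n)) > 2 ^ n"
    and incr: "\<And>n. norm (\<phi> (s (Suc n))) > norm (\<phi> (s n))" by blast
  have "strict_mono (\<lambda>n. norm (\<phi> (s n)))" using incr by (rule strict_monoI_Suc)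
  then have inj: "inj s" by (metis injI strict_mono_eq)
  define f where "f = (\<lambda>v. if v \<in> range s then (1/2) ^ (inv s v) else (0 :: complex))"
  have f_s: "f (s n) = (1/2) ^ n" for n using inj by (simp add: f_def)
  have transfer: "F summable_on A \<longleftrightarrow> (F \<circ> s) summable_on UNIV"
    if "\<And>v. v \<notin> range s \<Longrightarrow> F v = 0" for F :: "'v \<Rightarrow> 'b :: {topological_comm_monoid_add, t2_space}"
  proof -
    have "F summable_on A \<longleftrightarrow> F summable_on range s"
      using s that by (intro summable_on_cong_neutral) auto
    then show ?thesis using summable_on_reindex[OF inj, of F] by simp
  qed
  have "(\<lambda>n. (1/2 :: real) ^ n) summable_on UNIV"
    by (rule norm_summable_imp_summable_on) (simp add: summable_geometric)
  then have "((\<lambda>v. norm (f v)) \<circ> s) summable_on UNIV"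
    by (simp add: o_def f_s norm_power norm_divide)
  then have "(\<lambda>v. norm (f v)) summable_on A"
    by (subst transfer) (auto simp: f_def)
  then have "f \<in> ell1 A" by (simp add: ell1_def)
  from summ[OF this] have "(\<lambda>v. f v * \<phi> v) summable_on A" .
  then have "(\<lambda>n. f (s n) * \<phi> (s n)) summable_on UNIV"
    by (subst (asm) transfer) (auto simp: f_def o_def)
  then have "summable (\<lambda>n. f (s n) * \<phi> (s n))"
    by (intro sums_summable has_sum_imp_sums) (rule has_sum_infsum)
  then have "(\<lambda>n. norm (f (s n) * \<phi> (s n))) \<longlonglongrightarrow> 0"
    using summable_LIMSEQ_zero tendsto_norm_zero by blast
  then have "eventually (\<lambda>n. norm (f (s n) * \<phi> (s n)) < 1) sequentially"
    by (rule order_tendstoD) simp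
  then obtain n where "norm (f (s n) * \<phi> (s n)) < 1"
    by (auto simp: eventually_sequentially)
  moreover have "norm (f (s n) * \<phi> (s n)) = norm (\<phi> (s n)) / 2 ^ n"
    by (simp add: f_s norm_mult norm_divide norm_power power_divide)
  ultimately show False using s(2)[of n] by simp
qed

theorem corollary4p2:
  fixes E :: "'v \<Rightarrow> 'v \<Rightarrow> bool"
    and Vp Vm :: "'v set"
    and qp qm :: nat
    and v0 :: 'v
    and M :: "('v \<Rightarrow> 'v) measure"
    and \<phi> :: "'v \<Rightarrow> complex"
  assumes "semihomogeneous_tree E Vp Vm qp qm"
    and "1 < qp" and "1 < qm" and "qp \<noteq> qm"
    and "v0 \<in> Vp"
    and "normalized_haar E v0 M"
    and "spherical_on_Vp E Vp qp qm v0 \<phi>"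
  shows "positive_functional M Vp v0 \<phi> \<longleftrightarrow> bounded (\<phi> ` Vp) \<and> (\<forall>v\<in>Vp. \<phi> v \<in> \<real>)"
proof -
  interpret haar_tree E Vp Vm qp qm v0 M
    using assms by unfold_locales
  note sph = assms(7)
  show ?thesis
  proof
    assume pos: "positive_functional M Vp v0 \<phi>"
    have bdd: "bounded (\<phi> ` Vp)"
      using pos by (intro bounded_if_summable_against_ell1) (auto simp: positive_functional_def)
    then obtain B where B: "\<forall>v\<in>Vp. norm (\<phi> v) \<le> B" by (auto simp: bounded_iff)
    have one: "\<phi> v0 = 1" using sph assms(5) unfolding spherical_on_Vp_def is_spherical_def by metis
    have "\<phi> v \<in> \<real>" if v: "v \<in> Vp" for v
    proof (cases "v = v0")
      case False
      show ?thesis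
      proof (rule real_if_one_plus_square_nonneg)
        fix t :: real
        define f where "f = (\<lambda>x. if x = v0 then 1 else if x = v then \<i> * t else 0)"
        have fsum: "f abs_summable_on Vp"
        proof -
          have "f abs_summable_on {v0, v}" by simp
          then show ?thesis
            by (subst abs_summable_on_cong_neutral[of _ "{v0, v}" _ f]) (auto simp: f_def v assms(5))
        qed
        then have "f \<in> ell1 Vp" by (simp add: ell1_def abs_summable_equivalent)
        then have "L_G M v0 \<phi> (convol M (involution (lift_fun v0 f)) (lift_fun v0 f)) \<in> \<real>\<^sub>\<ge>\<^sub>0"
          using pos by (auto simp: positive_functional_def Let_def)
        moreover have 1: "infsetsum (\<lambda>x. f x * \<phi> x) Vp = 1 + \<i> * t * \<phi> v"
          using False v assms(5) one by (subst infsetsum_two_points[of v0 _ v]) (auto simp: f_def)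
        moreover have 2: "infsetsum (\<lambda>x. cnj (f x) * \<phi> x) Vp = 1 - \<i> * t * \<phi> v"
          using False v assms(5) one by (subst infsetsum_two_points[of v0 _ v]) (auto simp: f_def)
        moreover have "(1 + \<i> * t * \<phi> v) * (1 - \<i> * t * \<phi> v) = 1 + of_real (t\<^sup>2) * (\<phi> v)\<^sup>2"
          by (simp add: algebra_simps power2_eq_square)
        ultimately show "1 + of_real (t\<^sup>2) * (\<phi> v)\<^sup>2 \<in> \<real>\<^sub>\<ge>\<^sub>0"
          unfolding L_G_spherical[OF sph fsum B] by (simp only: 1 2)
      qed
    qed (simp add: one)
    with bdd show "bounded (\<phi> ` Vp) \<and> (\<forall>v\<in>Vp. \<phi> v \<in> \<real>)" by blast
  next
    assume R: "bounded (\<phi> ` Vp) \<and> (\<forall>v\<in>Vp. \<phi> v \<in> \<real>)"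
    then obtain B where B: "\<forall>v\<in>Vp. norm (\<phi> v) \<le> B" by (auto simp: bounded_iff)
    have abs: "f abs_summable_on Vp" if "f \<in> ell1 Vp" for f
      using that by (simp add: ell1_def abs_summable_equivalent)
    have "(\<lambda>v. f v * \<phi> v) summable_on Vp" if "f \<in> ell1 Vp" for f
      using abs_summable_mult_bounded[OF abs[OF that] B]
      by (simp add: summable_on_iff_abs_summable_on_complex abs_summable_equivalent)
    moreover have "L_G M v0 \<phi> (convol M (involution (lift_fun v0 f)) (lift_fun v0 f)) \<in> \<real>\<^sub>\<ge>\<^sub>0"
      if "f \<in> ell1 Vp" for f
    proof -
      let ?z = "infsetsum (\<lambda>v. f v * \<phi> v) Vp"
      have "infsetsum (\<lambda>v. cnj (f v) * \<phi> v) Vp = infsetsum (\<lambda>v. cnj (f v * \<phi> v)) Vp"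
        using R by (intro infsetsum_cong refl) (auto simp: Reals_cnj_iff)
      also have "\<dots> = cnj ?z" unfolding infsetsum_def by (rule Bochner_Integration.integral_cnj)
      finally show ?thesis
        unfolding L_G_spherical[OF sph abs[OF that] B]
        by (simp add: complex_norm_square[symmetric] flip: of_real_power)
    qed
    ultimately show "positive_functional M Vp v0 \<phi>"
      using L_G_convol(1)[OF abs B] by (auto simp: positive_functional_def Let_def)
  qed
qed

end
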